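(* Let $\mathcal{B}$ be a uniformly convex Banach space with modulus of uniform convexity $u$. Let $G$ be an amenable group which is countable discrete or locally compact second countable, with Følner sequence $(F_n)$, acting strongly on $\mathcal{B}$ via a representation $\pi:G\to\mathcal{L}_1(\mathcal{B},\mathcal{B})$, and let $\beta(n,\delta)$ be a Følner convergence modulus for $(F_n)$ which is non-decreasing in $n$. Fix $\varepsilon>0$ and $x\in\mathcal{B}$ with $x\neq 0$ and $\Vert x\Vert\le 1$, and fix $\eta$ with $0<\eta<\frac12 u(\varepsilon)$. Then the sequence $(A_nx)$, $A_nx=\frac{1}{|F_n|}\int_{F_n}\pi(g^{-1})x\,dg$, has at most $$\left\lfloor\frac{2\Vert x\Vert}{u(\varepsilon)-2\eta}\right\rfloor$$ $\varepsilon$-fluctuations at distance $\beta\left(n,\frac{\eta}{3\Vert x\Vert}\right)$. Moreover, if $L$ is a real number with $\inf_n\Vert A_nx\Vert\ge L$, then $(A_nx)$ has at most $$\left\lfloor\frac{2(\Vert x\Vert-L)}{u(\varepsilon)-2\eta}\right\rfloor$$ $\varepsilon$-fluctuations at distance $\beta\left(n,\frac{\eta}{3\Vert x\Vert}\right)$.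
   Context: Groups carry a (left) Haar measure, denoted $dg$ or $|\cdot|$ (counting measure if $G$ is countable discrete). Modulus of uniform convexity: a nondecreasing function $u:(0,\infty)\to(0,\infty)$ such that for all $x,y\in\mathcal{B}$ with $\Vert x\Vert\le\Vert y\Vert\le1$ and $\Vert x-y\Vert\ge\varepsilon$ one has $\Vert\frac12(x+y)\Vert<\Vert y\Vert-u(\varepsilon)$; $\mathcal{B}$ is uniformly convex if such a $u$ exists. Action: $\mathcal{L}_1(\mathcal{B},\mathcal{B})$ is the set of linear operators on $\mathcal{B}$ of operator norm $1$. $G$ acts strongly on $\mathcal{B}$ via $\pi:G\to\mathcal{L}_1(\mathcal{B},\mathcal{B})$ if $\pi(e)=\mathrm{id}$, $\pi(g)\pi(h)=\pi(gh)$ for all $g,h\in G$, and for every $x\in\mathcal{B}$ the map $g\mapsto\pi(g)x$ is strongly measurable, i.e. a pointwise norm-limit of simple measurable functions $G\to\mathcal{B}$ (automatic if $G$ is countable discrete). $\mathcal{B}$-valued integrals are Bochner integrals. Følner sequence: if $G$ is countable discrete, a sequence $(F_n)$ of nonempty finite subsets such that for every $\varepsilon>0$ and finite $K\subset G$ there is $N$ with $|F_n\Delta kF_n|<\varepsilon|F_n|$ for all $n\ge N$, $k\in K$. If $G$ is locally compact second countable (lcsc), a sequence $(F_n)$ of compact subsets of positive Haar measure such that for every $\varepsilon>0$ and compact $K\subset G$ there is $N$ such that for all $n\ge N$ there is a measurable $K'\subset K$ with $|K'|>(1-\varepsilon)|K|$ and $|F_n\Delta kF_n|<\varepsilon|F_n|$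 for all $k\in K'$. A group is amenable if it has a Følner sequence. Følner convergence modulus: a function $\beta(n,\varepsilon)$ returning, for each $n$ and $\varepsilon>0$, an integer $N$ such that: (countable discrete case) for all $m\ge N$ and $g\in F_n$, $|F_m\Delta gF_m|<\varepsilon|F_m|$; (lcsc case) for all $m\ge N$ there is a measurable $F_n'\subset F_n$ with $|F_n\setminus F_n'|<\varepsilon|F_n|$ and $|F_m\Delta gF_m|<\varepsilon|F_m|$ for all $g\in F_n'$. Fluctuations at distance: for $b:\mathbb{N}\to\mathbb{N}$, a sequence $(x_n)$ has at most $M$ $\varepsilon$-fluctuations at distance $b(n)$ if, whenever $n_0<n_1<\dots<n_k$ are indices with $n_{i+1}\ge b(n_i)$ and $\Vert x_{n_i}-x_{n_{i+1}}\Vert\ge\varepsilon$ for all $0\le i<k$, one has $k\le M$. *)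

theory Defs
  imports "HOL-Analysis.Analysis" "HOL-Algebra.Coset"
begin

definition uniform_convexity_modulus :: "'b::real_normed_vector itself \<Rightarrow> (real \<Rightarrow> real) \<Rightarrow> bool" where
  "uniform_convexity_modulus _ u \<longleftrightarrow>
     (\<forall>\<epsilon>>0. u \<epsilon> > 0) \<and> mono_on {0<..} u \<and>
     (\<forall>\<epsilon>>0. \<forall>x y::'b. norm x \<le> norm y \<and> norm y \<le> 1 \<and> norm (x - y) \<ge> \<epsilon>
        \<longrightarrow> norm ((1/2) *\<^sub>R (x + y)) < norm y - u \<epsilon>)"


(* The Bochner integral of the library is restricted to second countable (separable) codomains.
   The following definitions copy it for arbitrary Banach spaces, with Borel measurability
   replaced by strong measurability; see bochner_int_eq_integral for the separable case. *)

definition strongly_measurable :: "'a measure \<Rightarrow> ('a \<Rightarrow> 'b::real_normed_vector) \<Rightarrow> bool" where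
  "strongly_measurable M f \<longleftrightarrow>
     (\<exists>s. (\<forall>i::nat. simple_function M (s i)) \<and> (\<forall>x\<in>space M. (\<lambda>i. s i x) \<longlonglongrightarrow> f x))"

definition has_bochner_int :: "'a measure \<Rightarrow> ('a \<Rightarrow> 'b) \<Rightarrow> 'b::real_normed_vector \<Rightarrow> bool" where
  "has_bochner_int M f I \<longleftrightarrow> strongly_measurable M f \<and>
     (\<exists>s. (\<forall>i::nat. Bochner_Integration.simple_bochner_integrable M (s i)) \<and>
          (\<lambda>i. \<integral>\<^sup>+x. norm (f x - s i x) \<partial>M) \<longlonglongrightarrow> 0 \<and>
          (\<lambda>i. Bochner_Integration.simple_bochner_integral M (s i)) \<longlonglongrightarrow> I)"

definition bochner_int :: "'a measure \<Rightarrow> ('a \<Rightarrow> 'b) \<Rightarrow> 'b::real_normed_vector" where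
  "bochner_int M f = (if \<exists>I. has_bochner_int M f I then THE I. has_bochner_int M f I else 0)"


lemma strongly_measurable_iff_borel_measurable:
  fixes f :: "'a \<Rightarrow> 'b::{real_normed_vector, second_countable_topology}"
  shows "strongly_measurable M f \<longleftrightarrow> f \<in> borel_measurable M"
proof
  assume "strongly_measurable M f"
  then obtain s where s: "\<And>i::nat. simple_function M (s i)"
    and lim: "\<And>x. x \<in> space M \<Longrightarrow> (\<lambda>i. s i x) \<longlonglongrightarrow> f x"
    unfolding strongly_measurable_def by blast
  show "f \<in> borel_measurable M"
    by (rule borel_measurable_LIMSEQ_metric[OF borel_measurable_simple_function[OF s] lim])
next
  assume "f \<in> borel_measurable M"
  from borel_measurable_implies_sequence_metric[OF this, of 0] show "strongly_measurable M f"
    unfolding strongly_measurable_def by (elim exE conjE) (intro exI conjI)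
qed

lemma bochner_int_eq_integral:
  fixes f :: "'a \<Rightarrow> 'b::{banach, second_countable_topology}"
  shows "bochner_int M f = integral\<^sup>L M f"
proof -
  have "has_bochner_int M f I \<longleftrightarrow> has_bochner_integral M f I" for I
    unfolding has_bochner_int_def strongly_measurable_iff_borel_measurable
    by (rule iffI) (elim conjE exE, rule has_bochner_integral.intros, assumption, erule spec, assumption, assumption,
      erule has_bochner_integral.cases, intro conjI exI allI, assumption+)
  then show ?thesis
    by (simp only: bochner_int_def lebesgue_integral_def)
qed


definition lcsc_group :: "('g, 'm) monoid_scheme \<Rightarrow> 'g topology \<Rightarrow> bool" where
  "lcsc_group G T \<longleftrightarrow>
     group G \<and> topspace T = carrier G \<and>
     continuous_map (prod_topology T T) T (\<lambda>(g, h). g \<otimes>\<^bsub>G\<^esub> h) \<and>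
     continuous_map T T (\<lambda>g. inv\<^bsub>G\<^esub> g) \<and>
     Hausdorff_space T \<and> locally_compact_space T \<and> second_countable T"

(* On the Borel sets of an lcsc group, regularity follows from finiteness on compact sets. *)
definition left_haar_measure :: "('g, 'm) monoid_scheme \<Rightarrow> 'g topology \<Rightarrow> 'g measure \<Rightarrow> bool" where
  "left_haar_measure G T M \<longleftrightarrow>
     space M = carrier G \<and> sets M = sigma_sets (carrier G) {U. openin T U} \<and>
     (\<forall>g\<in>carrier G. \<forall>A\<in>sets M. emeasure M (g <#\<^bsub>G\<^esub> A) = emeasure M A) \<and>
     (\<forall>K. compactin T K \<longrightarrow> emeasure M K < \<infinity>) \<and>
     emeasure M (carrier G) \<noteq> 0"

definition folner_discrete ::
  "('g, 'm) monoid_scheme \<Rightarrow> 'g measure \<Rightarrow> (nat \<Rightarrow> 'g set) \<Rightarrow> bool" where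
  "folner_discrete G M F \<longleftrightarrow>
     (\<forall>n. finite (F n) \<and> F n \<noteq> {} \<and> F n \<subseteq> carrier G) \<and>
     (\<forall>\<epsilon>>0. \<forall>K. finite K \<and> K \<subseteq> carrier G \<longrightarrow>
        (\<exists>N. \<forall>n\<ge>N. \<forall>k\<in>K.
           measure M (sym_diff (F n) (k <#\<^bsub>G\<^esub> F n)) < \<epsilon> * measure M (F n)))"

(* K ranges over the compact sets of positive measure: for a null set K (such as {}), no K' can
   satisfy the strict inequality |K'| > (1 - \<epsilon>) |K|, so no sequence would be Folner. *)
definition folner_lcsc ::
  "('g, 'm) monoid_scheme \<Rightarrow> 'g topology \<Rightarrow> 'g measure \<Rightarrow> (nat \<Rightarrow> 'g set) \<Rightarrow> bool" where
  "folner_lcsc G T M F \<longleftrightarrow>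
     (\<forall>n. compactin T (F n) \<and> measure M (F n) > 0) \<and>
     (\<forall>\<epsilon>>0. \<forall>K. compactin T K \<and> measure M K > 0 \<longrightarrow>
        (\<exists>N. \<forall>n\<ge>N. \<exists>K'\<in>sets M. K' \<subseteq> K \<and> measure M K' > (1 - \<epsilon>) * measure M K \<and>
           (\<forall>k\<in>K'. measure M (sym_diff (F n) (k <#\<^bsub>G\<^esub> F n)) < \<epsilon> * measure M (F n))))"

definition folner_modulus_discrete ::
  "('g, 'm) monoid_scheme \<Rightarrow> 'g measure \<Rightarrow> (nat \<Rightarrow> 'g set) \<Rightarrow> (nat \<Rightarrow> real \<Rightarrow> nat) \<Rightarrow> bool" where
  "folner_modulus_discrete G M F \<beta> \<longleftrightarrow>
     (\<forall>n. \<forall>\<epsilon>>0. \<forall>m\<ge>\<beta> n \<epsilon>. \<forall>g\<in>F n.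
        measure M (sym_diff (F m) (g <#\<^bsub>G\<^esub> F m)) < \<epsilon> * measure M (F m))"

definition folner_modulus_lcsc ::
  "('g, 'm) monoid_scheme \<Rightarrow> 'g measure \<Rightarrow> (nat \<Rightarrow> 'g set) \<Rightarrow> (nat \<Rightarrow> real \<Rightarrow> nat) \<Rightarrow> bool" where
  "folner_modulus_lcsc G M F \<beta> \<longleftrightarrow>
     (\<forall>n. \<forall>\<epsilon>>0. \<forall>m\<ge>\<beta> n \<epsilon>. \<exists>F'\<in>sets M. F' \<subseteq> F n \<and>
        measure M (F n - F') < \<epsilon> * measure M (F n) \<and>
        (\<forall>g\<in>F'. measure M (sym_diff (F m) (g <#\<^bsub>G\<^esub> F m)) < \<epsilon> * measure M (F m)))"

definition acts_strongly ::
  "('g, 'm) monoid_scheme \<Rightarrow> 'g measure \<Rightarrow> ('g \<Rightarrow> 'b::real_normed_vector \<Rightarrow>\<^sub>L 'b) \<Rightarrow> bool" where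
  "acts_strongly G M \<pi> \<longleftrightarrow>
     (\<forall>g\<in>carrier G. norm (\<pi> g) = 1) \<and>
     \<pi> \<one>\<^bsub>G\<^esub> = id_blinfun \<and>
     (\<forall>g\<in>carrier G. \<forall>h\<in>carrier G. \<pi> g o\<^sub>L \<pi> h = \<pi> (g \<otimes>\<^bsub>G\<^esub> h)) \<and>
     (\<forall>x. strongly_measurable M (\<lambda>g. blinfun_apply (\<pi> g) x))"

definition ergodic_average ::
  "('g, 'm) monoid_scheme \<Rightarrow> 'g measure \<Rightarrow> ('g \<Rightarrow> 'b::real_normed_vector \<Rightarrow>\<^sub>L 'b) \<Rightarrow>
     (nat \<Rightarrow> 'g set) \<Rightarrow> nat \<Rightarrow> 'b \<Rightarrow> 'b" where
  "ergodic_average G M \<pi> F n x =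
     (1 / measure M (F n)) *\<^sub>R
       bochner_int M (\<lambda>g. indicat_real (F n) g *\<^sub>R blinfun_apply (\<pi> (inv\<^bsub>G\<^esub> g)) x)"

(* The indices are n 0 < ... < n k; values of n beyond k are irrelevant.
   The bound is an integer so that it can be compared with a floor. *)
definition at_most_fluctuations_at_distance ::
  "int \<Rightarrow> real \<Rightarrow> (nat \<Rightarrow> nat) \<Rightarrow> (nat \<Rightarrow> 'b::real_normed_vector) \<Rightarrow> bool" where
  "at_most_fluctuations_at_distance B \<epsilon> b X \<longleftrightarrow>
     (\<forall>k. \<forall>n :: nat \<Rightarrow> nat.
        (\<forall>i<k. n i < n (Suc i) \<and> b (n i) \<le> n (Suc i) \<and> norm (X (n i) - X (n (Suc i))) \<ge> \<epsilon>)
        \<longrightarrow> int k \<le> B)"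

end

theory Submission
  imports Defs
begin

text \<open>
  If \<open>m \<ge> \<beta>(n, \<delta>)\<close>, then \<open>A\<^sub>m\<close> almost absorbs \<open>A\<^sub>n\<close>: by invariance of the measure,
  \<open>A\<^sub>m \<pi>(h\<^sup>-\<^sup>1) x\<close> is the average of the same orbit over \<open>h F\<^sub>m\<close>, which barely differs from \<open>F\<^sub>m\<close>
  for most \<open>h \<in> F\<^sub>n\<close>, so \<open>\<parallel>A\<^sub>m A\<^sub>n x - A\<^sub>m x\<parallel> \<le> 3 \<delta> \<parallel>x\<parallel>\<close>. As \<open>A\<^sub>m\<close> is a bounded operator it
  commutes with the integral defining \<open>A\<^sub>n x\<close>, and no Fubini theorem is needed.
  If \<open>A\<^sub>n x\<close> and \<open>A\<^sub>m x\<close> are at distance at least \<open>\<epsilon>\<close>, uniform convexity makes their midpoint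
  shorter by \<open>u(\<epsilon>)\<close>, and every later \<open>A\<^sub>p x\<close> is up to an error \<open>\<eta>\<close> the image of this midpoint
  under the contraction \<open>A\<^sub>p\<close>. Hence every two fluctuations decrease the norm of the average by
  \<open>u(\<epsilon>) - 2 \<eta>\<close>, which can happen only boundedly often.
\<close>

section \<open>Bochner integration of strongly measurable functions\<close>

lemma strongly_measurable_imp_borel_measurable:
  assumes "strongly_measurable M f"
  shows "f \<in> borel_measurable M"
proof -
  obtain s where s: "\<And>i::nat. simple_function M (s i)"
    and lim: "\<And>x. x \<in> space M \<Longrightarrow> (\<lambda>i. s i x) \<longlonglongrightarrow> f x"
    using assms unfolding strongly_measurable_def by blast
  show ?thesis
    by (rule borel_measurable_LIMSEQ_metric[OF borel_measurable_simple_function[OF s] lim])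
qed

lemma strongly_measurable_simple_function:
  "simple_function M f \<Longrightarrow> strongly_measurable M f"
  unfolding strongly_measurable_def by (rule exI[of _ "\<lambda>_. f"]) auto

text \<open>The approximating sequences are added rather than the limits: in a non-separable space a
  sum of two Borel functions need not be Borel, so Borel measurability would not be enough to carry
  the closure properties.\<close>

lemma strongly_measurable_add:
  assumes "strongly_measurable M f" "strongly_measurable M g"
  shows "strongly_measurable M (\<lambda>x. f x + g x)"
proof -
  obtain s where s: "\<And>i::nat. simple_function M (s i)"
    and slim: "\<And>x. x \<in> space M \<Longrightarrow> (\<lambda>i. s i x) \<longlonglongrightarrow> f x"
    using assms(1) unfolding strongly_measurable_def by blast
  obtain t where t: "\<And>i::nat. simple_function M (t i)"
    and tlim: "\<And>x. x \<in> space M \<Longrightarrow> (\<lambda>i. t i x) \<longlonglongrightarrow> g x"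
    using assms(2) unfolding strongly_measurable_def by blast
  show ?thesis
    unfolding strongly_measurable_def
    by (rule exI[of _ "\<lambda>i x. s i x + t i x"])
       (auto intro!: simple_function_compose2[OF s t] tendsto_add slim tlim)
qed

lemma strongly_measurable_bounded_linear:
  assumes "bounded_linear T" "strongly_measurable M f"
  shows "strongly_measurable M (\<lambda>x. T (f x))"
proof -
  obtain s where s: "\<And>i::nat. simple_function M (s i)"
    and slim: "\<And>x. x \<in> space M \<Longrightarrow> (\<lambda>i. s i x) \<longlonglongrightarrow> f x"
    using assms(2) unfolding strongly_measurable_def by blast
  show ?thesis
    unfolding strongly_measurable_def
    by (rule exI[of _ "\<lambda>i x. T (s i x)"])
       (auto intro!: simple_function_compose1[OF s] bounded_linear.tendsto[OF assms(1)] slim)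
qed

lemma strongly_measurable_diff:
  assumes "strongly_measurable M f" "strongly_measurable M g"
  shows "strongly_measurable M (\<lambda>x. f x - g x)"
  using strongly_measurable_add[OF assms(1)
      strongly_measurable_bounded_linear[OF bounded_linear_minus[OF bounded_linear_ident] assms(2)]]
  by simp

lemma strongly_measurable_indicator_scaleR:
  assumes "A \<in> sets M" "strongly_measurable M f"
  shows "strongly_measurable M (\<lambda>x. indicat_real A x *\<^sub>R f x)"
proof -
  obtain s where s: "\<And>i::nat. simple_function M (s i)"
    and slim: "\<And>x. x \<in> space M \<Longrightarrow> (\<lambda>i. s i x) \<longlonglongrightarrow> f x"
    using assms(2) unfolding strongly_measurable_def by blast
  show ?thesis
    unfolding strongly_measurable_def
    by (rule exI[of _ "\<lambda>i x. indicat_real A x *\<^sub>R s i x"])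
       (auto intro!: simple_function_compose2[OF simple_function_indicator[OF assms(1)] s]
         tendsto_intros slim)
qed

lemma simple_function_comp_measurable:
  assumes "simple_function N f" "\<phi> \<in> measurable M N"
  shows "simple_function M (\<lambda>x. f (\<phi> x))"
proof -
  have "f \<in> measurable N (count_space UNIV)"
    using assms(1) by (rule measurable_simple_function)
  then have "(\<lambda>x. f (\<phi> x)) \<in> measurable M (count_space UNIV)"
    using assms(2) by (rule measurable_compose[rotated])
  moreover have "finite ((\<lambda>x. f (\<phi> x)) ` space M)"
    by (rule finite_subset[of _ "f ` space N"])
       (use assms in \<open>auto dest: simple_functionD measurable_space\<close>)
  ultimately show ?thesis
    by (auto simp: simple_function_def)
qed

lemma strongly_measurable_comp:
  assumes "strongly_measurable N f" "\<phi> \<in> measurable M N"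
  shows "strongly_measurable M (\<lambda>x. f (\<phi> x))"
proof -
  obtain s where s: "\<And>i::nat. simple_function N (s i)"
    and slim: "\<And>x. x \<in> space N \<Longrightarrow> (\<lambda>i. s i x) \<longlonglongrightarrow> f x"
    using assms(1) unfolding strongly_measurable_def by blast
  show ?thesis
    unfolding strongly_measurable_def
    by (rule exI[of _ "\<lambda>i x. s i (\<phi> x)"])
       (auto intro!: simple_function_comp_measurable[OF s assms(2)] slim
         measurable_space[OF assms(2)])
qed

section \<open>Approximation by simple functions and the basic laws of the integral\<close>

lemma borel_measurable_norm_diff_simple:
  assumes "strongly_measurable M f" "Bochner_Integration.simple_bochner_integrable M s"
  shows "(\<lambda>x. norm (f x - s x)) \<in> borel_measurable M"
proof -
  have "simple_function M s"
    using assms(2) by (rule simple_bochner_integrable.cases)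
  then have "(\<lambda>x. f x - s x) \<in> borel_measurable M"
    by (intro strongly_measurable_imp_borel_measurable strongly_measurable_diff assms(1)
        strongly_measurable_simple_function)
  then show ?thesis
    by (rule measurable_compose[OF _ borel_measurable_continuous_onI]) (intro continuous_intros)
qed

text \<open>The triangle inequality through \<open>f\<close>. This one estimate yields uniqueness of
  the integral, its norm bound (with \<open>t = 0\<close>), and the Cauchy property behind its
  existence (with \<open>s\<close> and \<open>t\<close> from the same sequence).\<close>

lemma simple_bochner_integral_diff_bound:
  assumes f: "strongly_measurable M f"
    and s: "Bochner_Integration.simple_bochner_integrable M s"
    and t: "Bochner_Integration.simple_bochner_integrable M t"
  shows "ennreal (norm (Bochner_Integration.simple_bochner_integral M s -
      Bochner_Integration.simple_bochner_integral M t)) \<le>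
    (\<integral>\<^sup>+ x. norm (f x - s x) \<partial>M) + (\<integral>\<^sup>+ x. norm (f x - t x) \<partial>M)"
    (is "ennreal (norm (?s - ?t)) \<le> ?S + ?T")
proof -
  \<comment> \<open>Measurability of the two norms is what makes \<open>nn_integral\<close> additive
    at the end of the chain.\<close>
  note [measurable] = borel_measurable_norm_diff_simple[OF f s] borel_measurable_norm_diff_simple[OF f t]
  have "ennreal (norm (?s - ?t)) = norm (Bochner_Integration.simple_bochner_integral M (\<lambda>x. s x - t x))"
    using s t by (subst simple_bochner_integral_diff) auto
  also have "\<dots> \<le> Bochner_Integration.simple_bochner_integral M (\<lambda>x. norm (s x - t x))"
    using simple_bochner_integrable_compose2[of "(-)" M "s" "t"] s t
    by (auto intro!: simple_bochner_integral_norm_bound)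
  also have "\<dots> = (\<integral>\<^sup>+x. norm (s x - t x) \<partial>M)"
    using simple_bochner_integrable_compose2[of "\<lambda>x y. norm (x - y)" M "s" "t"] s t
    by (auto intro!: simple_bochner_integral_eq_nn_integral)
  also have "\<dots> \<le> (\<integral>\<^sup>+x. ennreal (norm (f x - s x)) + ennreal (norm (f x - t x)) \<partial>M)"
  proof (rule nn_integral_mono)
    fix x
    have "norm (s x - t x) \<le> norm (f x - s x) + norm (f x - t x)"
      by (metis dual_order.refl norm_diff_triangle_le norm_minus_commute)
    then show "ennreal (norm (s x - t x)) \<le> ennreal (norm (f x - s x)) + ennreal (norm (f x - t x))"
      by (simp add: ennreal_leI flip: ennreal_plus)
  qed
  also have "\<dots> = ?S + ?T"
    by (rule nn_integral_add) auto
  finally show ?thesis .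
qed

lemma has_bochner_intE:
  assumes "has_bochner_int M f I"
  obtains s where "strongly_measurable M f"
    and "\<And>i::nat. Bochner_Integration.simple_bochner_integrable M (s i)"
    and "(\<lambda>i. \<integral>\<^sup>+x. norm (f x - s i x) \<partial>M) \<longlonglongrightarrow> 0"
    and "(\<lambda>i. Bochner_Integration.simple_bochner_integral M (s i)) \<longlonglongrightarrow> I"
  using assms unfolding has_bochner_int_def by blast

lemma has_bochner_intI:
  assumes "strongly_measurable M f"
    and "\<And>i::nat. Bochner_Integration.simple_bochner_integrable M (s i)"
    and "(\<lambda>i. \<integral>\<^sup>+x. norm (f x - s i x) \<partial>M) \<longlonglongrightarrow> 0"
    and "(\<lambda>i. Bochner_Integration.simple_bochner_integral M (s i)) \<longlonglongrightarrow> I"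
  shows "has_bochner_int M f I"
  unfolding has_bochner_int_def using assms by (intro conjI exI[of _ s] allI)

lemma has_bochner_int_unique:
  assumes "has_bochner_int M f I" "has_bochner_int M f J"
  shows "I = J"
proof -
  obtain s where f: "strongly_measurable M f"
    and s: "\<And>i::nat. Bochner_Integration.simple_bochner_integrable M (s i)"
    and s0: "(\<lambda>i. \<integral>\<^sup>+x. norm (f x - s i x) \<partial>M) \<longlonglongrightarrow> 0"
    and sI: "(\<lambda>i. Bochner_Integration.simple_bochner_integral M (s i)) \<longlonglongrightarrow> I"
    using assms(1) by (rule has_bochner_intE) blast
  obtain t where t: "\<And>i::nat. Bochner_Integration.simple_bochner_integrable M (t i)"
    and t0: "(\<lambda>i. \<integral>\<^sup>+x. norm (f x - t i x) \<partial>M) \<longlonglongrightarrow> 0"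
    and tJ: "(\<lambda>i. Bochner_Integration.simple_bochner_integral M (t i)) \<longlonglongrightarrow> J"
    using assms(2) by (rule has_bochner_intE) blast
  have "(\<lambda>i. ennreal (norm (Bochner_Integration.simple_bochner_integral M (s i) -
      Bochner_Integration.simple_bochner_integral M (t i)))) \<longlonglongrightarrow> ennreal (norm (I - J))"
    by (intro tendsto_intros sI tJ)
  moreover have "(\<lambda>i. (\<integral>\<^sup>+x. norm (f x - s i x) \<partial>M) + (\<integral>\<^sup>+x. norm (f x - t i x) \<partial>M)) \<longlonglongrightarrow> 0 + 0"
    by (intro tendsto_add s0 t0)
  ultimately have "ennreal (norm (I - J)) \<le> 0 + 0"
    by (rule LIMSEQ_le) (use simple_bochner_integral_diff_bound[OF f s t] in blast)
  then show ?thesis by simp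
qed

lemma bochner_int_eq:
  "has_bochner_int M f I \<Longrightarrow> bochner_int M f = I"
  unfolding bochner_int_def by (auto intro: has_bochner_int_unique)

lemma has_bochner_int_norm_bound:
  fixes f :: "'a \<Rightarrow> 'b::real_normed_vector"
  assumes "has_bochner_int M f I"
  shows "ennreal (norm I) \<le> (\<integral>\<^sup>+x. norm (f x) \<partial>M)"
proof -
  obtain s where f: "strongly_measurable M f"
    and s: "\<And>i::nat. Bochner_Integration.simple_bochner_integrable M (s i)"
    and s0: "(\<lambda>i. \<integral>\<^sup>+x. norm (f x - s i x) \<partial>M) \<longlonglongrightarrow> 0"
    and sI: "(\<lambda>i. Bochner_Integration.simple_bochner_integral M (s i)) \<longlonglongrightarrow> I"
    using assms by (rule has_bochner_intE) blast
  \<comment> \<open>The norm bound comes from comparing \<open>s i\<close> with the zero function,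
    whose distance to \<open>f\<close> is the integral of \<open>norm (f x)\<close>.\<close>
  have zero: "Bochner_Integration.simple_bochner_integrable M (\<lambda>_. 0)"
    by (rule simple_bochner_integrable.intros) auto
  have zero_int: "Bochner_Integration.simple_bochner_integral M (\<lambda>_. 0 :: 'b) = 0"
    unfolding simple_bochner_integral_def by (rule sum.neutral) auto
  have "(\<lambda>i. ennreal (norm (Bochner_Integration.simple_bochner_integral M (s i)))) \<longlonglongrightarrow> ennreal (norm I)"
    by (intro tendsto_intros sI)
  moreover have "(\<lambda>i. (\<integral>\<^sup>+x. norm (f x - s i x) \<partial>M) + (\<integral>\<^sup>+x. norm (f x) \<partial>M))
      \<longlonglongrightarrow> 0 + (\<integral>\<^sup>+x. norm (f x) \<partial>M)"
    by (intro tendsto_add s0 tendsto_const)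
  ultimately have "ennreal (norm I) \<le> 0 + (\<integral>\<^sup>+x. norm (f x) \<partial>M)"
    by (rule LIMSEQ_le)
       (use simple_bochner_integral_diff_bound[OF f s zero] in \<open>simp add: zero_int\<close>)
  then show ?thesis by simp
qed

lemma has_bochner_int_add:
  assumes "has_bochner_int M f I" "has_bochner_int M g J"
  shows "has_bochner_int M (\<lambda>x. f x + g x) (I + J)"
proof -
  obtain s where f: "strongly_measurable M f"
    and s: "\<And>i::nat. Bochner_Integration.simple_bochner_integrable M (s i)"
    and s0: "(\<lambda>i. \<integral>\<^sup>+x. norm (f x - s i x) \<partial>M) \<longlonglongrightarrow> 0"
    and sI: "(\<lambda>i. Bochner_Integration.simple_bochner_integral M (s i)) \<longlonglongrightarrow> I"
    using assms(1) by (rule has_bochner_intE) blast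
  obtain t where g: "strongly_measurable M g"
    and t: "\<And>i::nat. Bochner_Integration.simple_bochner_integrable M (t i)"
    and t0: "(\<lambda>i. \<integral>\<^sup>+x. norm (g x - t i x) \<partial>M) \<longlonglongrightarrow> 0"
    and tJ: "(\<lambda>i. Bochner_Integration.simple_bochner_integral M (t i)) \<longlonglongrightarrow> J"
    using assms(2) by (rule has_bochner_intE) blast
  note [measurable] = borel_measurable_norm_diff_simple[OF f s] borel_measurable_norm_diff_simple[OF g t]
  have st: "Bochner_Integration.simple_bochner_integrable M (\<lambda>x. s i x + t i x)" for i
    by (rule simple_bochner_integrable_compose2[OF _ s t]) simp
  have le: "(\<integral>\<^sup>+x. norm (f x + g x - (s i x + t i x)) \<partial>M)
      \<le> (\<integral>\<^sup>+x. norm (f x - s i x) \<partial>M) + (\<integral>\<^sup>+x. norm (g x - t i x) \<partial>M)" for i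
  proof -
    have "(\<integral>\<^sup>+x. norm (f x + g x - (s i x + t i x)) \<partial>M)
        \<le> (\<integral>\<^sup>+x. ennreal (norm (f x - s i x)) + ennreal (norm (g x - t i x)) \<partial>M)"
      by (auto intro!: nn_integral_mono norm_diff_triangle_ineq simp flip: ennreal_plus)
    also have "\<dots> = (\<integral>\<^sup>+x. norm (f x - s i x) \<partial>M) + (\<integral>\<^sup>+x. norm (g x - t i x) \<partial>M)"
      by (rule nn_integral_add) auto
    finally show ?thesis .
  qed
  have "(\<lambda>i. \<integral>\<^sup>+x. norm (f x + g x - (s i x + t i x)) \<partial>M) \<longlonglongrightarrow> 0"
    by (rule tendsto_sandwich[OF _ _ tendsto_const tendsto_add[OF s0 t0, simplified]])
       (use le in auto)
  moreover have "(\<lambda>i. Bochner_Integration.simple_bochner_integral M (\<lambda>x. s i x + t i x)) \<longlonglongrightarrow> I + J"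
    by (subst simple_bochner_integral_add[OF s t]) (intro tendsto_add sI tJ)
  ultimately show ?thesis
    by (rule has_bochner_intI[OF strongly_measurable_add[OF f g] st])
qed

lemma has_bochner_int_bounded_linear:
  assumes T: "bounded_linear T" and "has_bochner_int M f I"
  shows "has_bochner_int M (\<lambda>x. T (f x)) (T I)"
proof -
  interpret T: bounded_linear T by fact
  obtain s where f: "strongly_measurable M f"
    and s: "\<And>i::nat. Bochner_Integration.simple_bochner_integrable M (s i)"
    and s0: "(\<lambda>i. \<integral>\<^sup>+x. norm (f x - s i x) \<partial>M) \<longlonglongrightarrow> 0"
    and sI: "(\<lambda>i. Bochner_Integration.simple_bochner_integral M (s i)) \<longlonglongrightarrow> I"
    using assms(2) by (rule has_bochner_intE) blast
  note [measurable] = borel_measurable_norm_diff_simple[OF f s]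
  have Ts: "Bochner_Integration.simple_bochner_integrable M (\<lambda>x. T (s i x))" for i
    by (rule simple_bochner_integrable_compose2[OF _ s s, where p="\<lambda>x y. T x"]) (rule T.zero)
  obtain K where K: "K > 0" "\<And>x i. norm (T (f x) - T (s i x)) \<le> norm (f x - s i x) * K"
    using T.pos_bounded by (auto simp: T.diff[symmetric])
  have le: "(\<integral>\<^sup>+x. norm (T (f x) - T (s i x)) \<partial>M) \<le> K * (\<integral>\<^sup>+x. norm (f x - s i x) \<partial>M)" for i
  proof -
    have "(\<integral>\<^sup>+x. norm (T (f x) - T (s i x)) \<partial>M) \<le> (\<integral>\<^sup>+x. ennreal K * norm (f x - s i x) \<partial>M)"
      using K by (auto intro!: nn_integral_mono simp: ac_simps simp flip: ennreal_mult)
    also have "\<dots> = K * (\<integral>\<^sup>+x. norm (f x - s i x) \<partial>M)"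
      by (rule nn_integral_cmult) auto
    finally show ?thesis .
  qed
  have "(\<lambda>i. ennreal K * (\<integral>\<^sup>+x. norm (f x - s i x) \<partial>M)) \<longlonglongrightarrow> ennreal K * 0"
    by (rule ennreal_tendsto_cmult[OF _ s0]) simp
  then have "(\<lambda>i. \<integral>\<^sup>+x. norm (T (f x) - T (s i x)) \<partial>M) \<longlonglongrightarrow> 0"
    unfolding mult_zero_right
    by (rule tendsto_sandwich[OF always_eventually always_eventually tendsto_const, rotated -1])
       (simp_all add: le)
  moreover have "(\<lambda>i. Bochner_Integration.simple_bochner_integral M (\<lambda>x. T (s i x))) \<longlonglongrightarrow> T I"
    by (subst simple_bochner_integral_linear[OF T.linear_axioms s]) (rule T.tendsto[OF sI])
  ultimately show ?thesis
    by (rule has_bochner_intI[OF strongly_measurable_bounded_linear[OF T f] Ts])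
qed

lemma has_bochner_int_diff:
  assumes "has_bochner_int M f I" "has_bochner_int M g J"
  shows "has_bochner_int M (\<lambda>x. f x - g x) (I - J)"
  using has_bochner_int_add[OF assms(1)
      has_bochner_int_bounded_linear[OF bounded_linear_minus[OF bounded_linear_ident] assms(2)]]
  by simp

lemma has_bochner_int_cong:
  assumes "\<And>x. x \<in> space M \<Longrightarrow> f x = g x"
  shows "has_bochner_int M f I \<longleftrightarrow> has_bochner_int M g I"
  unfolding has_bochner_int_def strongly_measurable_def
  using assms by (simp cong: nn_integral_cong)

text \<open>The real-valued indicator is its own approximation; the vector-valued case is its image
  under the bounded linear map that sends a scalar \<open>r\<close> to
  \<open>r *\<^sub>R c\<close>.\<close>

lemma has_bochner_int_indicator:
  fixes c :: "'b::real_normed_vector"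
  assumes A: "A \<in> sets M" "emeasure M A < \<infinity>"
  shows "has_bochner_int M (\<lambda>x. indicat_real A x *\<^sub>R c) (measure M A *\<^sub>R c)"
proof -
  have "Bochner_Integration.simple_bochner_integrable M (indicat_real A)"
    using A sets.sets_into_space[OF A(1)]
    by (auto intro!: simple_bochner_integrable.intros simple_function_indicator simp: indicator_eq_0_iff Int_absorb1 Collect_conj_eq)
  then have "has_bochner_int M (indicat_real A) (Bochner_Integration.simple_bochner_integral M (indicat_real A))"
    unfolding has_bochner_int_def
    by (auto intro!: exI[of _ "\<lambda>_. indicat_real A"] strongly_measurable_simple_function
        elim: simple_bochner_integrable.cases simp flip: zero_ennreal_def)
  moreover have "Bochner_Integration.simple_bochner_integral M (indicat_real A) = measure M A"
    using \<open>Bochner_Integration.simple_bochner_integrable M (indicat_real A)\<close> A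
    by (intro ennreal_inj[THEN iffD1])
       (simp_all add: simple_bochner_integral_eq_nn_integral ennreal_indicator emeasure_eq_ennreal_measure)
  ultimately show ?thesis
    using has_bochner_int_bounded_linear[OF bounded_linear_scaleR_left] by metis
qed

text \<open>Existence of the integral. Truncated simple approximations converge to the integrand in
  mean by dominated convergence, so their integrals form a Cauchy sequence, and completeness of the
  space provides the limit.\<close>

lemma has_bochner_int_indicator_bounded:
  fixes f :: "'a \<Rightarrow> 'b::banach"
  assumes A: "A \<in> sets M" "emeasure M A < \<infinity>"
    and f: "strongly_measurable M f" and bound: "\<And>x. x \<in> space M \<Longrightarrow> norm (f x) \<le> C"
  shows "has_bochner_int M (\<lambda>x. indicat_real A x *\<^sub>R f x) (bochner_int M (\<lambda>x. indicat_real A x *\<^sub>R f x))"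
proof -
  define g where "g = (\<lambda>x. indicat_real A x *\<^sub>R f x)"
  have g: "strongly_measurable M g"
    unfolding g_def by (rule strongly_measurable_indicator_scaleR[OF A(1) f])
  obtain s where s: "\<And>i::nat. simple_function M (s i)"
    and lim: "\<And>x. x \<in> space M \<Longrightarrow> (\<lambda>i. s i x) \<longlonglongrightarrow> f x"
    using f unfolding strongly_measurable_def by blast
  note [measurable] = borel_measurable_simple_function[OF s] A(1)
  \<comment> \<open>The cut-off is \<open>C + 1\<close> and not \<open>C\<close>: since
    \<open>norm (f x) < C + 1\<close> strictly, \<open>s i x\<close> eventually escapes truncation
    even where \<open>norm (f x) = C\<close>.\<close>
  define t where "t i x = (if x \<in> A \<and> norm (s i x) \<le> C + 1 then s i x else 0)" for i x
  have t_simple: "simple_function M (t i)" for i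
    unfolding t_def[abs_def] by (rule simple_function_If[OF s simple_function_const]) measurable
  have t: "Bochner_Integration.simple_bochner_integrable M (t i)" for i
  proof (rule simple_bochner_integrable.intros[OF t_simple])
    have "emeasure M {y \<in> space M. t i y \<noteq> 0} \<le> emeasure M A"
      by (rule emeasure_mono) (auto simp: t_def A)
    with A(2) show "emeasure M {y \<in> space M. t i y \<noteq> 0} \<noteq> \<infinity>"
      by (auto simp: top_unique)
  qed
  have t_lim: "(\<lambda>i. t i x) \<longlonglongrightarrow> g x" if x: "x \<in> space M" for x
  proof (cases "x \<in> A")
    case True
    have "(\<lambda>i. norm (s i x)) \<longlonglongrightarrow> norm (f x)"
      by (intro tendsto_norm lim x)
    moreover have "norm (f x) < C + 1"
      using bound[OF x] by simp
    ultimately have "\<forall>\<^sub>F i in sequentially. norm (s i x) < C + 1"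
      by (rule order_tendstoD)
    then have "\<forall>\<^sub>F i in sequentially. s i x = t i x"
      by eventually_elim (use True in \<open>auto simp: t_def\<close>)
    then show ?thesis
      using lim[OF x] True by (auto simp: g_def intro: Lim_transform_eventually)
  qed (simp add: t_def g_def)
  have t0: "(\<lambda>i. \<integral>\<^sup>+x. norm (g x - t i x) \<partial>M) \<longlonglongrightarrow> 0"
  proof -
    note [measurable] = borel_measurable_norm_diff_simple[OF g t]
    have "(\<lambda>i. \<integral>\<^sup>+x. norm (g x - t i x) \<partial>M) \<longlonglongrightarrow> (\<integral>\<^sup>+x. 0 \<partial>M)"
    \<comment> \<open>The constant is \<open>C + (C + 1)\<close>, a bound for \<open>f\<close> plus
      the bound for its truncated approximation.\<close>
    proof (rule nn_integral_dominated_convergence[where w="\<lambda>x. ennreal (2 * C + 1) * indicator A x"])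
      show "(\<integral>\<^sup>+x. ennreal (2 * C + 1) * indicator A x \<partial>M) < \<infinity>"
        using A by (simp add: nn_integral_cmult_indicator ennreal_mult_less_top)
      show "AE x in M. (\<lambda>i. ennreal (norm (g x - t i x))) \<longlonglongrightarrow> 0"
      proof (rule AE_I2)
        fix x assume "x \<in> space M"
        then have "(\<lambda>i. ennreal (norm (g x - t i x))) \<longlonglongrightarrow> ennreal (norm (g x - g x))"
          by (intro tendsto_intros t_lim)
        then show "(\<lambda>i. ennreal (norm (g x - t i x))) \<longlonglongrightarrow> 0" by simp
      qed
      show "AE x in M. ennreal (norm (g x - t i x)) \<le> ennreal (2 * C + 1) * indicator A x" for i
      proof (rule AE_I2)
        fix x assume x: "x \<in> space M"
        have C: "0 \<le> C" using bound[OF x] norm_ge_zero[of "f x"] by linarith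
        have "norm (t i x) \<le> C + 1" using C by (auto simp: t_def)
        then have "norm (f x - t i x) \<le> 2 * C + 1"
          using bound[OF x] norm_triangle_ineq4[of "f x" "t i x"] by linarith
        then show "ennreal (norm (g x - t i x)) \<le> ennreal (2 * C + 1) * indicator A x"
          by (auto simp: g_def t_def indicator_def intro: ennreal_leI)
      qed
    qed auto
    then show ?thesis by simp
  qed
  have "Cauchy (\<lambda>i. Bochner_Integration.simple_bochner_integral M (t i))"
  proof (rule CauchyI)
    fix r :: real assume r: "0 < r"
    have "\<forall>\<^sub>F i in sequentially. (\<integral>\<^sup>+x. norm (g x - t i x) \<partial>M) < ennreal (r / 2)"
      by (rule order_tendstoD(2)[OF t0]) (use r in simp)
    then obtain N where N: "\<And>i. i \<ge> N \<Longrightarrow> (\<integral>\<^sup>+x. norm (g x - t i x) \<partial>M) < ennreal (r / 2)"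
      by (auto simp: eventually_sequentially)
    have "norm (Bochner_Integration.simple_bochner_integral M (t i) -
        Bochner_Integration.simple_bochner_integral M (t j)) < r" if "i \<ge> N" "j \<ge> N" for i j
    proof -
      have "ennreal (norm (Bochner_Integration.simple_bochner_integral M (t i) -
        Bochner_Integration.simple_bochner_integral M (t j))) < ennreal (r / 2) + ennreal (r / 2)"
        by (rule le_less_trans[OF simple_bochner_integral_diff_bound[OF g t t] add_strict_mono])
           (use N that in auto)
      also have "\<dots> = ennreal r"
        using r by (simp flip: ennreal_plus)
      finally show ?thesis by (simp add: ennreal_less_iff)
    qed
    then show "\<exists>N. \<forall>i\<ge>N. \<forall>j\<ge>N. norm (Bochner_Integration.simple_bochner_integral M (t i) -
        Bochner_Integration.simple_bochner_integral M (t j)) < r" by blast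
  qed
  then obtain I where "(\<lambda>i. Bochner_Integration.simple_bochner_integral M (t i)) \<longlonglongrightarrow> I"
    using Cauchy_convergent convergentD by blast
  then have "has_bochner_int M g I"
    by (rule has_bochner_intI[OF g t t0])
  then show ?thesis
    using bochner_int_eq[of M g I] unfolding g_def by simp
qed

text \<open>Change of variables. Composing the approximants with \<open>\<phi>\<close> preserves the
  measure of every level set, hence their integrals, and preserves their mean distance to the
  integrand.\<close>

lemma has_bochner_int_measure_preserving:
  assumes \<phi>: "\<phi> \<in> measurable M M" and pres: "distr M M \<phi> = M"
    and "has_bochner_int M f I"
  shows "has_bochner_int M (\<lambda>x. f (\<phi> x)) I"
proof -
  obtain s where f: "strongly_measurable M f"
    and s: "\<And>i::nat. Bochner_Integration.simple_bochner_integrable M (s i)"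
    and s0: "(\<lambda>i. \<integral>\<^sup>+x. norm (f x - s i x) \<partial>M) \<longlonglongrightarrow> 0"
    and sI: "(\<lambda>i. Bochner_Integration.simple_bochner_integral M (s i)) \<longlonglongrightarrow> I"
    using assms(3) by (rule has_bochner_intE) blast
  have simple: "simple_function M (s i)" for i
    using s by (rule simple_bochner_integrable.cases)
  have count: "s i \<in> measurable M (count_space UNIV)" for i
    by (rule measurable_simple_function[OF simple])
  have preimage: "\<phi> -` {x \<in> space M. P (s i x)} \<inter> space M = {x \<in> space M. P (s i (\<phi> x))}" for P i
    using measurable_space[OF \<phi>] by auto
  have in_sets: "{x \<in> space M. P (s i x)} \<in> sets M" for P i
    using measurable_sets[OF count, of "{y. P y}" i] by (simp add: vimage_def Int_def conj_commute)
  have level: "emeasure M {x \<in> space M. P (s i (\<phi> x))} = emeasure M {x \<in> space M. P (s i x)}" for P i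
    using emeasure_distr[OF \<phi> in_sets[of P i]] unfolding pres preimage by simp
  have s\<phi>: "Bochner_Integration.simple_bochner_integrable M (\<lambda>x. s i (\<phi> x))" for i
    using s[of i] level[of "\<lambda>y. y \<noteq> 0" i]
    by (intro simple_bochner_integrable.intros simple_function_comp_measurable[OF simple \<phi>])
       (simp add: simple_bochner_integrable.simps)
  have "Bochner_Integration.simple_bochner_integral M (\<lambda>x. s i (\<phi> x))
      = Bochner_Integration.simple_bochner_integral M (s i)" for i
    unfolding simple_bochner_integral_def measure_def level[of "\<lambda>z. z = y" for y]
  \<comment> \<open>\<open>s i\<close> may take values that its composition with
    \<open>\<phi>\<close> misses. Such a value has an empty level set after composition, so its
    level set before composition is null and contributes nothing.\<close>
  proof (rule sum.mono_neutral_left)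
    show "finite (s i ` space M)" using simple by (rule simple_functionD)
    show "(\<lambda>x. s i (\<phi> x)) ` space M \<subseteq> s i ` space M"
      using measurable_space[OF \<phi>] by auto
    show "\<forall>y\<in>s i ` space M - (\<lambda>x. s i (\<phi> x)) ` space M.
        enn2real (emeasure M {x \<in> space M. s i x = y}) *\<^sub>R y = 0"
    proof
      fix y assume y: "y \<in> s i ` space M - (\<lambda>x. s i (\<phi> x)) ` space M"
      then have "{x \<in> space M. s i (\<phi> x) = y} = {}" by blast
      with level[of "\<lambda>z. z = y" i] show "enn2real (emeasure M {x \<in> space M. s i x = y}) *\<^sub>R y = 0"
        by simp
    qed
  qed
  moreover have "(\<integral>\<^sup>+x. norm (f (\<phi> x) - s i (\<phi> x)) \<partial>M) = (\<integral>\<^sup>+x. norm (f x - s i x) \<partial>M)" for i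
  proof -
    have "(\<integral>\<^sup>+x. norm (f x - s i x) \<partial>M) = (\<integral>\<^sup>+x. norm (f x - s i x) \<partial>distr M M \<phi>)"
      by (simp add: pres)
    also have "\<dots> = (\<integral>\<^sup>+x. norm (f (\<phi> x) - s i (\<phi> x)) \<partial>M)"
      by (rule nn_integral_distr[OF \<phi>])
         (use borel_measurable_norm_diff_simple[OF f s] in \<open>simp add: pres\<close>)
    finally show ?thesis by simp
  qed
  ultimately show ?thesis
    using s0 sI
    by (intro has_bochner_intI[OF strongly_measurable_comp[OF f \<phi>] s\<phi>]) simp_all
qed

text \<open>Two sets are allowed because \<open>norm_avg_avg_le\<close> needs a small bound on most
  points and a crude one on an exceptional set; a single bound is the case
  \<open>d = 0\<close>.\<close>

lemma has_bochner_int_norm_le: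
  fixes f :: "'a \<Rightarrow> 'b::real_normed_vector"
  assumes "has_bochner_int M f I"
    and A: "A \<in> sets M" "emeasure M A < \<infinity>" and B: "B \<in> sets M" "emeasure M B < \<infinity>"
    and "0 \<le> c" "0 \<le> d"
    and le: "\<And>x. x \<in> space M \<Longrightarrow> norm (f x) \<le> c * indicat_real A x + d * indicat_real B x"
  shows "norm I \<le> c * measure M A + d * measure M B"
proof -
  note [measurable] = A(1) B(1)
  have "ennreal (norm I) \<le> (\<integral>\<^sup>+x. norm (f x) \<partial>M)"
    by (rule has_bochner_int_norm_bound[OF assms(1)])
  also have "\<dots> \<le> (\<integral>\<^sup>+x. ennreal c * indicator A x + ennreal d * indicator B x \<partial>M)"
  proof (rule nn_integral_mono)
    fix x assume "x \<in> space M"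
    from ennreal_leI[OF le[OF this]] \<open>0 \<le> c\<close> \<open>0 \<le> d\<close>
    show "ennreal (norm (f x)) \<le> ennreal c * indicator A x + ennreal d * indicator B x"
      by (auto simp: indicator_def split: if_splits)
  qed
  also have "\<dots> = ennreal c * emeasure M A + ennreal d * emeasure M B"
    by (simp add: nn_integral_add nn_integral_cmult_indicator)
  also have "\<dots> = ennreal (c * measure M A + d * measure M B)"
    using A B \<open>0 \<le> c\<close> \<open>0 \<le> d\<close>
    by (simp add: emeasure_eq_ennreal_measure less_top ennreal_mult)
  finally show ?thesis
    using \<open>0 \<le> c\<close> \<open>0 \<le> d\<close> by (simp flip: ennreal_plus)
qed

section \<open>Ergodic averages along a Folner sequence\<close>

text \<open>Common ground of the discrete and the lcsc case: of the topology only its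
  measure-theoretic consequences are kept, and the modulus has the lcsc form, of which the discrete
  one is an instance.\<close>

locale folner_action = group G
  for G :: "('g, 'm) monoid_scheme" (structure) +
  fixes M :: "'g measure" and F :: "nat \<Rightarrow> 'g set" and \<beta> :: "nat \<Rightarrow> real \<Rightarrow> nat"
    and \<pi> :: "'g \<Rightarrow> 'b::banach \<Rightarrow>\<^sub>L 'b"
  assumes space_M: "space M = carrier G"
    and translation_measurable: "g \<in> carrier G \<Longrightarrow> (\<lambda>h. g \<otimes> h) \<in> measurable M M"
    and emeasure_l_coset: "g \<in> carrier G \<Longrightarrow> A \<in> sets M \<Longrightarrow> emeasure M (g <# A) = emeasure M A"
    and inverse_measurable: "(\<lambda>g. inv g) \<in> measurable M M"
    and F_sets: "F n \<in> sets M"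
    and F_finite: "emeasure M (F n) < \<infinity>"
    and F_pos: "0 < measure M (F n)"
    and modulus: "folner_modulus_lcsc G M F \<beta>"
    and action: "acts_strongly G M \<pi>"
begin

abbreviation avg :: "nat \<Rightarrow> 'b \<Rightarrow> 'b" where
  "avg \<equiv> ergodic_average G M \<pi> F"

text \<open>Turns cosets into preimages under translation by the inverse, so that they are
  measurable and invariance of \<open>M\<close> on cosets becomes invariance under the maps
  \<open>h \<mapsto> g \<otimes> h\<close>.\<close>

lemma l_coset_eq_preimage:
  assumes "g \<in> carrier G" "A \<subseteq> carrier G"
  shows "g <# A = (\<lambda>h. inv g \<otimes> h) -` A \<inter> carrier G"
proof (intro equalityI subsetI)
  fix h assume "h \<in> g <# A"
  then show "h \<in> (\<lambda>h. inv g \<otimes> h) -` A \<inter> carrier G"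
    using assms by (auto simp: l_coset_def m_assoc[symmetric])
next
  fix h assume h: "h \<in> (\<lambda>h. inv g \<otimes> h) -` A \<inter> carrier G"
  then have "h = g \<otimes> (inv g \<otimes> h)"
    using assms by (simp add: m_assoc[symmetric])
  then show "h \<in> g <# A"
    using h unfolding l_coset_def by blast
qed

lemma l_coset_sets:
  assumes "g \<in> carrier G" "A \<in> sets M"
  shows "g <# A \<in> sets M"
  using measurable_sets[OF translation_measurable assms(2), of "inv g"] assms
    sets.sets_into_space[OF assms(2)]
  by (simp add: l_coset_eq_preimage space_M)

lemma distr_translation:
  assumes g: "g \<in> carrier G"
  shows "distr M M (\<lambda>h. g \<otimes> h) = M"
proof (rule measure_eqI)
  fix A assume "A \<in> sets (distr M M (\<lambda>h. g \<otimes> h))"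
  then have A: "A \<in> sets M" by simp
  have "emeasure (distr M M (\<lambda>h. g \<otimes> h)) A = emeasure M ((\<lambda>h. g \<otimes> h) -` A \<inter> space M)"
    by (rule emeasure_distr[OF translation_measurable[OF g] A])
  also have "(\<lambda>h. g \<otimes> h) -` A \<inter> space M = inv g <# A"
    using g sets.sets_into_space[OF A] by (simp add: l_coset_eq_preimage space_M)
  also have "emeasure M \<dots> = emeasure M A"
    using g A by (simp add: emeasure_l_coset)
  finally show "emeasure (distr M M (\<lambda>h. g \<otimes> h)) A = emeasure M A" .
qed simp

section \<open>The averages as linear contractions\<close>

lemma F_subset: "F n \<subseteq> carrier G"
  using sets.sets_into_space[OF F_sets] by (simp add: space_M)

lemma norm_action_le: "g \<in> carrier G \<Longrightarrow> norm (\<pi> g y) \<le> norm y"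
  using action norm_blinfun[of "\<pi> g" y] by (simp add: acts_strongly_def)

lemma action_mult:
  "g \<in> carrier G \<Longrightarrow> h \<in> carrier G \<Longrightarrow> \<pi> (g \<otimes> h) y = \<pi> g (\<pi> h y)"
  using action unfolding acts_strongly_def by (metis blinfun_apply_blinfun_compose)

text \<open>The action supplies measurability of \<open>g \<mapsto> \<pi> g y\<close>, whereas the
  averages involve inverses; measurability of inversion bridges the gap.\<close>

lemma strongly_measurable_inverse_orbit: "strongly_measurable M (\<lambda>g. \<pi> (inv g) y)"
  using strongly_measurable_comp[OF _ inverse_measurable] action
  unfolding acts_strongly_def by blast

lemma has_bochner_int_inverse_orbit:
  assumes "A \<in> sets M" "emeasure M A < \<infinity>"
  shows "has_bochner_int M (\<lambda>g. indicat_real A g *\<^sub>R \<pi> (inv g) y)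
    (bochner_int M (\<lambda>g. indicat_real A g *\<^sub>R \<pi> (inv g) y))"
  by (rule has_bochner_int_indicator_bounded[OF assms strongly_measurable_inverse_orbit, where C = "norm y"])
     (simp add: norm_action_le space_M)

lemma has_bochner_int_avg:
  "has_bochner_int M (\<lambda>g. indicat_real (F n) g *\<^sub>R \<pi> (inv g) y) (measure M (F n) *\<^sub>R avg n y)"
  using has_bochner_int_inverse_orbit[OF F_sets F_finite] F_pos[of n]
  by (simp add: ergodic_average_def)

lemma avg_eqI:
  assumes "has_bochner_int M (\<lambda>g. indicat_real (F n) g *\<^sub>R \<pi> (inv g) y) (measure M (F n) *\<^sub>R z)"
  shows "avg n y = z"
  using has_bochner_int_unique[OF has_bochner_int_avg assms] F_pos[of n] by simp

lemma norm_avg_le: "norm (avg n y) \<le> norm y"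
proof -
  have "norm (measure M (F n) *\<^sub>R avg n y) \<le> norm y * measure M (F n) + 0 * measure M (F n)"
    by (rule has_bochner_int_norm_le[OF has_bochner_int_avg F_sets F_finite F_sets F_finite])
       (auto simp: indicator_def space_M norm_action_le)
  then show ?thesis using F_pos[of n] by (simp add: mult.commute)
qed

text \<open>Since \<open>bochner_int\<close> takes the default value 0 where no integral exists,
  linearity rests on existence and is transferred through \<open>avg_eqI\<close>. The constant 1
  says that averaging is a contraction.\<close>

lemma bounded_linear_avg: "bounded_linear (avg n)"
proof (rule bounded_linear_intro[where K = 1])
  show "avg n (y + z) = avg n y + avg n z" for y z
    by (rule avg_eqI)
       (use has_bochner_int_add[OF has_bochner_int_avg[of n y] has_bochner_int_avg[of n z]]
        in \<open>simp add: blinfun.add_right scaleR_add_right\<close>)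
  show "avg n (r *\<^sub>R y) = r *\<^sub>R avg n y" for r y
    by (rule avg_eqI)
       (use has_bochner_int_bounded_linear[OF bounded_linear_scaleR_right has_bochner_int_avg[of n y], of r]
        in \<open>simp add: blinfun.scaleR_right mult.commute\<close>)
  show "norm (avg n y) \<le> norm y * 1" for y
    by (simp add: norm_avg_le)
qed

text \<open>As \<open>inv (h \<otimes> g) = inv g \<otimes> inv h\<close>, the substitution of
  \<open>h \<otimes> g\<close> for \<open>g\<close> turns the integral of the orbit of
  \<open>y\<close> over \<open>h <# F m\<close> into the integral of the orbit of
  \<open>\<pi> (inv h) y\<close> over \<open>F m\<close>. Both sides thus integrate one orbit over
  two nearby sets.\<close>

lemma norm_avg_translate_le:
  assumes h: "h \<in> carrier G"
  shows "measure M (F m) * norm (avg m (\<pi> (inv h) y) - avg m y)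
    \<le> measure M (sym_diff (F m) (h <# F m)) * norm y"
proof -
  have hF: "h <# F m \<in> sets M" by (rule l_coset_sets[OF h F_sets])
  have hF_finite: "emeasure M (h <# F m) < \<infinity>"
    using emeasure_l_coset[OF h F_sets] F_finite by simp
  define J where "J = bochner_int M (\<lambda>g. indicat_real (h <# F m) g *\<^sub>R \<pi> (inv g) y)"
  have J: "has_bochner_int M (\<lambda>g. indicat_real (h <# F m) g *\<^sub>R \<pi> (inv g) y) J"
    unfolding J_def by (rule has_bochner_int_inverse_orbit[OF hF hF_finite])
  have "has_bochner_int M (\<lambda>g. indicat_real (h <# F m) (h \<otimes> g) *\<^sub>R \<pi> (inv (h \<otimes> g)) y) J"
    by (rule has_bochner_int_measure_preserving[OF translation_measurable[OF h] distr_translation[OF h] J])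
  also have "?this \<longleftrightarrow> has_bochner_int M (\<lambda>g. indicat_real (F m) g *\<^sub>R \<pi> (inv g) (\<pi> (inv h) y)) J"
  proof (rule has_bochner_int_cong)
    fix g assume "g \<in> space M"
    then have g: "g \<in> carrier G" by (simp add: space_M)
    then have "h \<otimes> g \<in> h <# F m \<longleftrightarrow> g \<in> F m"
      using h F_subset[of m] by (auto simp: l_coset_eq_preimage m_assoc[symmetric])
    then show "indicat_real (h <# F m) (h \<otimes> g) *\<^sub>R \<pi> (inv (h \<otimes> g)) y
        = indicat_real (F m) g *\<^sub>R \<pi> (inv g) (\<pi> (inv h) y)"
      using g h by (simp add: indicator_def inv_mult_group action_mult)
  qed
  finally have "J = measure M (F m) *\<^sub>R avg m (\<pi> (inv h) y)"
    by (rule has_bochner_int_unique) (rule has_bochner_int_avg)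
  with has_bochner_int_diff[OF J has_bochner_int_avg[of m y]]
  have diff: "has_bochner_int M
      (\<lambda>g. indicat_real (h <# F m) g *\<^sub>R \<pi> (inv g) y - indicat_real (F m) g *\<^sub>R \<pi> (inv g) y)
      (measure M (F m) *\<^sub>R (avg m (\<pi> (inv h) y) - avg m y))"
    by (simp add: scaleR_diff_right)
  have S: "sym_diff (F m) (h <# F m) \<in> sets M"
    using F_sets hF by (intro sets.Un sets.Diff)
  have "emeasure M (sym_diff (F m) (h <# F m)) \<le> emeasure M (F m) + emeasure M (h <# F m)"
    by (rule order_trans[OF emeasure_mono emeasure_subadditive[OF F_sets hF]])
       (use F_sets hF in auto)
  also have "\<dots> < \<infinity>" using F_finite hF_finite by simp
  finally have S_finite: "emeasure M (sym_diff (F m) (h <# F m)) < \<infinity>" .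
  \<comment> \<open>Off the symmetric difference the two indicators agree and the integrand
    vanishes; on it exactly one of them is 1, leaving a single orbit vector of norm at most
    \<open>norm y\<close>.\<close>
  have "norm (measure M (F m) *\<^sub>R (avg m (\<pi> (inv h) y) - avg m y))
      \<le> norm y * measure M (sym_diff (F m) (h <# F m)) + 0 * measure M (F m)"
    by (rule has_bochner_int_norm_le[OF diff S S_finite F_sets F_finite])
       (auto simp: indicator_def space_M norm_action_le)
  then show ?thesis using F_pos[of m] by (simp add: mult.commute)
qed

text \<open>The factor 3 is 1 + 2: points of \<open>F'\<close> contribute an error \<delta> by
  near-invariance of \<open>F m\<close>, and the exceptional set, a fraction less than \<delta> of
  \<open>F n\<close>, contributes twice the norm of \<open>y\<close>.\<close>

lemma norm_avg_avg_le:
  assumes "0 < \<delta>" "\<beta> n \<delta> \<le> m"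
  shows "norm (avg m (avg n y) - avg m y) \<le> 3 * \<delta> * norm y"
proof -
  interpret A: bounded_linear "avg m" by (rule bounded_linear_avg)
  obtain F' where F': "F' \<in> sets M" "F' \<subseteq> F n"
    and small: "measure M (F n - F') < \<delta> * measure M (F n)"
    and inv: "\<forall>g\<in>F'. measure M (sym_diff (F m) (g <# F m)) < \<delta> * measure M (F m)"
    using modulus[unfolded folner_modulus_lcsc_def, rule_format, OF assms] by (elim bexE conjE)
  have D: "F n - F' \<in> sets M" "emeasure M (F n - F') < \<infinity>"
    using F_sets F' F_finite[of n] le_less_trans[OF emeasure_mono[of "F n - F'" "F n" M]] by auto
  have good: "norm (avg m (\<pi> (inv h) y) - avg m y) \<le> \<delta> * norm y" if "h \<in> F'" for h
  proof -
    have "h \<in> carrier G" using that F' F_subset by auto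
    then have "measure M (F m) * norm (avg m (\<pi> (inv h) y) - avg m y)
        \<le> measure M (sym_diff (F m) (h <# F m)) * norm y"
      by (rule norm_avg_translate_le)
    also have "\<dots> \<le> \<delta> * measure M (F m) * norm y"
      by (intro mult_right_mono less_imp_le[OF inv[rule_format, OF that]]) simp
    also have "\<dots> = measure M (F m) * (\<delta> * norm y)" by simp
    finally show ?thesis using F_pos[of m] by simp
  qed
  have bad: "norm (avg m (\<pi> (inv h) y) - avg m y) \<le> 2 * norm y" if "h \<in> carrier G" for h
    using norm_triangle_ineq4[of "avg m (\<pi> (inv h) y)" "avg m y"]
      norm_avg_le[of m "\<pi> (inv h) y"] norm_avg_le[of m y] norm_action_le[of "inv h" y] that
    by simp
  \<comment> \<open>The bounded operator \<open>avg m\<close> is moved inside the integral defining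
    \<open>avg n y\<close>, and the constant \<open>avg m y\<close> is written as an integral over
    \<open>F n\<close>, so that the difference can be estimated pointwise.\<close>
  have "has_bochner_int M
      (\<lambda>h. avg m (indicat_real (F n) h *\<^sub>R \<pi> (inv h) y) - indicat_real (F n) h *\<^sub>R avg m y)
      (avg m (measure M (F n) *\<^sub>R avg n y) - measure M (F n) *\<^sub>R avg m y)"
    by (intro has_bochner_int_diff has_bochner_int_bounded_linear[OF bounded_linear_avg]
        has_bochner_int_avg has_bochner_int_indicator F_sets F_finite)
  then have "has_bochner_int M
      (\<lambda>h. indicat_real (F n) h *\<^sub>R (avg m (\<pi> (inv h) y) - avg m y))
      (measure M (F n) *\<^sub>R (avg m (avg n y) - avg m y))"
    by (simp add: A.scaleR scaleR_diff_right)
  then have "norm (measure M (F n) *\<^sub>R (avg m (avg n y) - avg m y))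
      \<le> \<delta> * norm y * measure M (F n) + 2 * norm y * measure M (F n - F')"
  proof (rule has_bochner_int_norm_le[OF _ F_sets F_finite D])
    fix h assume "h \<in> space M"
    then have "h \<in> carrier G" by (simp add: space_M)
    \<comment> \<open>The small term is charged on all of \<open>F n\<close>, including the
      exceptional set, which is harmless since it is nonnegative.\<close>
    moreover have "0 \<le> \<delta> * norm y" using \<open>0 < \<delta>\<close> by simp
    ultimately show "norm (indicat_real (F n) h *\<^sub>R (avg m (\<pi> (inv h) y) - avg m y))
        \<le> \<delta> * norm y * indicat_real (F n) h + 2 * norm y * indicat_real (F n - F') h"
      using good[of h] bad[of h] by (auto simp: indicator_def)
  qed (use \<open>0 < \<delta>\<close> in auto)
  also have "\<dots> \<le> \<delta> * norm y * measure M (F n) + 2 * norm y * (\<delta> * measure M (F n))"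
    by (intro add_left_mono mult_left_mono less_imp_le[OF small]) simp
  also have "\<dots> = measure M (F n) * (3 * \<delta> * norm y)" by (simp add: algebra_simps)
  finally show ?thesis using F_pos[of n] by simp
qed

section \<open>Decrease of the norm along fluctuations\<close>

lemma norm_avg_le_norm_avg:
  assumes "0 < \<delta>" "\<beta> n \<delta> \<le> m"
  shows "norm (avg m y) \<le> norm (avg n y) + 3 * \<delta> * norm y"
  using norm_avg_avg_le[OF assms, of y] norm_avg_le[of m "avg n y"]
    norm_triangle_ineq2[of "avg m y" "avg m (avg n y)"] norm_minus_commute[of "avg m y" "avg m (avg n y)"]
  by linarith

text \<open>The gain \<open>u \<epsilon>\<close> from the midpoint is diminished by two errors of
  size \<open>3 * \<delta> * norm x\<close>: one because \<open>avg m x\<close> may be slightly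
  longer than \<open>avg n x\<close>, one for replacing \<open>avg p x\<close> by the image of the
  midpoint. The index \<open>p\<close> must be late for both \<open>n\<close> and \<open>m\<close>,
  as \<open>avg p\<close> has to absorb both averages.\<close>

lemma norm_avg_drop:
  assumes u: "uniform_convexity_modulus TYPE('b) u" and "0 < \<epsilon>" "norm x \<le> 1" "0 < \<delta>"
    and m: "\<beta> n \<delta> \<le> m" and p: "\<beta> n \<delta> \<le> p" "\<beta> m \<delta> \<le> p"
    and fluct: "\<epsilon> \<le> norm (avg n x - avg m x)"
  shows "norm (avg p x) \<le> norm (avg n x) - (u \<epsilon> - 2 * (3 * \<delta> * norm x))"
proof -
  interpret A: bounded_linear "avg p" by (rule bounded_linear_avg)
  define e where "e = 3 * \<delta> * norm x"
  have convex: "norm ((1/2) *\<^sub>R (y + z)) < norm z - u \<epsilon>"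
    if "norm y \<le> norm z" "norm z \<le> 1" "\<epsilon> \<le> norm (y - z)" for y z :: 'b
    using u \<open>0 < \<epsilon>\<close> that unfolding uniform_convexity_modulus_def by blast
  have le1: "norm (avg k x) \<le> 1" for k
    using norm_avg_le[of k x] \<open>norm x \<le> 1\<close> by simp
  \<comment> \<open>Uniform convexity measures against the longer vector, and either average may be
    that one; hence the maximum.\<close>
  have "norm ((1/2) *\<^sub>R (avg n x + avg m x)) \<le> max (norm (avg n x)) (norm (avg m x)) - u \<epsilon>"
  proof (cases "norm (avg n x) \<le> norm (avg m x)")
    case True
    from convex[OF this le1 fluct] True show ?thesis by simp
  next
    case False
    with convex[of "avg m x" "avg n x"] le1 fluct show ?thesis
      by (simp add: norm_minus_commute add.commute)
  qed
  moreover have "norm (avg m x) \<le> norm (avg n x) + e"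
    unfolding e_def by (rule norm_avg_le_norm_avg[OF \<open>0 < \<delta>\<close> m])
  moreover have "0 \<le> e" using \<open>0 < \<delta>\<close> by (simp add: e_def)
  ultimately have mid: "norm ((1/2) *\<^sub>R (avg n x + avg m x)) \<le> norm (avg n x) + e - u \<epsilon>"
    by linarith
  \<comment> \<open>The error at the midpoint is the mean of the errors at \<open>avg n x\<close>
    and \<open>avg m x\<close>, so it is no larger than the common bound \<open>e\<close>.\<close>
  have "avg p ((1/2) *\<^sub>R (avg n x + avg m x)) - avg p x
      = (1/2) *\<^sub>R ((avg p (avg n x) - avg p x) + (avg p (avg m x) - avg p x))"
  proof -
    have "(avg p (avg n x) - avg p x) + (avg p (avg m x) - avg p x)
        = (avg p (avg n x) + avg p (avg m x)) - (avg p x + avg p x)" by simp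
    then show ?thesis by (simp only: A.scaleR A.add scaleR_diff_right scaleR_half_double)
  qed
  also have "norm \<dots> \<le> (1/2) * (e + e)"
    unfolding norm_scaleR e_def
    using norm_avg_avg_le[OF \<open>0 < \<delta>\<close> p(1), of x] norm_avg_avg_le[OF \<open>0 < \<delta>\<close> p(2), of x]
      norm_triangle_ineq[of "avg p (avg n x) - avg p x" "avg p (avg m x) - avg p x"]
    by simp
  finally have "norm (avg p x) \<le> norm (avg p ((1/2) *\<^sub>R (avg n x + avg m x))) + e"
    using norm_triangle_ineq2[of "avg p x" "avg p ((1/2) *\<^sub>R (avg n x + avg m x))"]
    by (simp add: norm_minus_commute)
  also have "\<dots> \<le> norm ((1/2) *\<^sub>R (avg n x + avg m x)) + e"
    by (simp only: add_le_cancel_right norm_avg_le)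
  finally show ?thesis using mid by (simp add: e_def)
qed

text \<open>A fluctuation between \<open>n i\<close> and \<open>n (Suc i)\<close> lowers the norm
  only at indices late for \<open>n (Suc i)\<close>, such as \<open>n (Suc (Suc i))\<close>. So one
  drop is gained per two steps of the chain, which is the source of the factor 2 in the
  bound.\<close>

lemma avg_fluctuations:
  assumes u: "uniform_convexity_modulus TYPE('b) u" and "0 < \<epsilon>" "norm x \<le> 1" "0 < \<delta>"
    and mono: "mono (\<lambda>n. \<beta> n \<delta>)"
    and small: "2 * (3 * \<delta> * norm x) < u \<epsilon>"
    and L: "\<And>n. L \<le> norm (avg n x)"
  shows "at_most_fluctuations_at_distance \<lfloor>2 * (norm x - L) / (u \<epsilon> - 2 * (3 * \<delta> * norm x))\<rfloor> \<epsilon>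
    (\<lambda>n. \<beta> n \<delta>) (\<lambda>n. avg n x)"
  unfolding at_most_fluctuations_at_distance_def
proof (intro allI impI)
  fix k :: nat and n :: "nat \<Rightarrow> nat"
  assume chain: "\<forall>i<k. n i < n (Suc i) \<and> \<beta> (n i) \<delta> \<le> n (Suc i) \<and>
      \<epsilon> \<le> norm (avg (n i) x - avg (n (Suc i)) x)"
  define c where "c = u \<epsilon> - 2 * (3 * \<delta> * norm x)"
  have drop: "norm (avg p x) \<le> norm (avg (n i) x) - c" if "i < k" "\<beta> (n (Suc i)) \<delta> \<le> p" for i p
  proof -
    \<comment> \<open>Here monotonicity of \<beta> in its first argument enters: an index late for
      \<open>n (Suc i)\<close> is late for \<open>n i\<close> as well.\<close>
    have "\<beta> (n i) \<delta> \<le> \<beta> (n (Suc i)) \<delta>"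
      using chain that(1) by (intro monoD[OF mono]) (simp add: less_imp_le)
    with that chain show ?thesis
      unfolding c_def
      by (intro norm_avg_drop[OF u \<open>0 < \<epsilon>\<close> \<open>norm x \<le> 1\<close> \<open>0 < \<delta>\<close>, of "n i" "n (Suc i)"]) auto
  qed
  have even_steps: "norm (avg (n (2 * j)) x) \<le> norm x - real j * c" if "2 * j \<le> k" for j
    using that
  proof (induction j)
    case 0
    then show ?case by (simp add: norm_avg_le)
  next
    case (Suc j)
    \<comment> \<open>By the distance condition \<open>n (2 * j + 2)\<close> is late for
      \<open>n (2 * j + 1)\<close> and can be taken as \<open>p\<close>.\<close>
    have "norm (avg (n (2 * Suc j)) x) \<le> norm (avg (n (2 * j)) x) - c"
      using Suc.prems chain by (intro drop) simp_all
    with Suc show ?case by (simp add: algebra_simps)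
  qed
  have "real k * c \<le> 2 * (norm x - L)"
  proof (cases "even k")
    case True
    then obtain j where "k = 2 * j" by (elim evenE)
    with even_steps[of j] L[of "n (2 * j)"] show ?thesis by simp
  next
    \<comment> \<open>The last fluctuation has no partner; any sufficiently late average takes its place.\<close>
    case False
    then obtain j where j: "k = 2 * j + 1" by (elim oddE)
    have "norm (avg (\<beta> (n (Suc (2 * j))) \<delta>) x) \<le> norm (avg (n (2 * j)) x) - c"
      by (rule drop) (simp_all add: j)
    moreover have "norm (avg (n (2 * j)) x) \<le> norm x - real j * c"
      by (rule even_steps) (simp add: j)
    \<comment> \<open>There are \<open>j + 1\<close> drops in total, worth
      \<open>(2 * j + 2) * c\<close> after doubling; the surplus over \<open>k * c\<close> is one
      \<open>c\<close>, discarded by its sign.\<close>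
    moreover have "0 \<le> c" using small by (simp add: c_def)
    ultimately show ?thesis
      using L[of "\<beta> (n (Suc (2 * j))) \<delta>"] by (simp add: j algebra_simps)
  qed
  then show "int k \<le> \<lfloor>2 * (norm x - L) / (u \<epsilon> - 2 * (3 * \<delta> * norm x))\<rfloor>"
    using small unfolding le_floor_iff c_def by (simp add: pos_le_divide_eq)
qed

end

section \<open>The two classes of groups as instances\<close>

lemma continuous_map_borel_measurable:
  assumes f: "continuous_map T T f" and "space M = topspace T"
    and "sets M = sigma_sets (topspace T) {U. openin T U}"
  shows "f \<in> measurable M M"
proof (rule measurable_sigma_sets)
  show "sets M = sigma_sets (topspace T) {U. openin T U}" by fact
  show "{U. openin T U} \<subseteq> Pow (topspace T)" by (auto dest: openin_subset)
  show "f \<in> space M \<rightarrow> topspace T"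
    using continuous_map_image_subset_topspace[OF f] by (auto simp: assms(2))
  fix U assume "U \<in> {U. openin T U}"
  then have "openin T {y \<in> topspace T. f y \<in> U}"
    by (intro openin_continuous_map_preimage[OF f]) simp
  moreover have "f -` U \<inter> space M = {y \<in> topspace T. f y \<in> U}" by (auto simp: assms(2))
  ultimately show "f -` U \<inter> space M \<in> sets M" by (auto simp: assms(3))
qed

lemma folner_action_lcsc:
  assumes T: "lcsc_group G T" and M: "left_haar_measure G T M" and F: "folner_lcsc G T M F"
    and \<beta>: "folner_modulus_lcsc G M F \<beta>" and \<pi>: "acts_strongly G M \<pi>"
  shows "folner_action G M F \<beta> \<pi>"
proof -
  interpret group G using T by (simp add: lcsc_group_def)
  have top: "topspace T = carrier G" using T by (simp add: lcsc_group_def)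
  have space: "space M = topspace T"
    and sets: "sets M = sigma_sets (topspace T) {U. openin T U}"
    using M by (simp_all add: left_haar_measure_def top)
  have compact: "compactin T (F n)" for n using F by (simp add: folner_lcsc_def)
  show ?thesis
  proof
    show "space M = carrier G" by (simp add: space top)
    show "(\<lambda>h. g \<otimes>\<^bsub>G\<^esub> h) \<in> measurable M M" if "g \<in> carrier G" for g
    proof (rule continuous_map_borel_measurable[OF _ space sets])
      have "continuous_map T (prod_topology T T) (\<lambda>h. (g, h))"
        using that by (simp add: continuous_map_pairwise o_def top)
      moreover have "continuous_map (prod_topology T T) T (\<lambda>(g, h). g \<otimes>\<^bsub>G\<^esub> h)"
        using T by (simp add: lcsc_group_def)
      ultimately show "continuous_map T T (\<lambda>h. g \<otimes>\<^bsub>G\<^esub> h)"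
        by (auto dest: continuous_map_compose simp: o_def)
    qed
    show "(\<lambda>g. inv\<^bsub>G\<^esub> g) \<in> measurable M M"
      using T by (intro continuous_map_borel_measurable[OF _ space sets]) (simp add: lcsc_group_def)
    show "emeasure M (g <#\<^bsub>G\<^esub> A) = emeasure M A" if "g \<in> carrier G" "A \<in> sets M" for g A
      using M that by (simp add: left_haar_measure_def)
    show "F n \<in> sets M" for n
    proof -
      \<comment> \<open>Compact sets are closed in a Hausdorff space, so \<open>F n\<close> is the
        complement of one of the open generators.\<close>
      have "closedin T (F n)"
        using T compact by (intro compactin_imp_closedin) (simp_all add: lcsc_group_def)
      then have "F n = topspace T - (topspace T - F n)" "openin T (topspace T - F n)"
        by (auto simp: closedin_def)
      then show ?thesis
        unfolding sets by (metis mem_Collect_eq sigma_sets.Basic sigma_sets.Compl)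
    qed
    show "emeasure M (F n) < \<infinity>" for n using M compact by (simp add: left_haar_measure_def)
    show "0 < measure M (F n)" for n using F by (simp add: folner_lcsc_def)
  qed fact+
qed

text \<open>Translation is injective and so preserves counting measure. In the modulus the whole of
  \<open>F n\<close> serves as \<open>F'\<close>: the exceptional set is empty, and its measure 0 is
  strictly below the bound because \<open>F n\<close> has positive measure.\<close>

lemma folner_action_discrete:
  fixes G (structure)
  assumes "group G" and F: "folner_discrete G (count_space (carrier G)) F"
    and \<beta>: "folner_modulus_discrete G (count_space (carrier G)) F \<beta>"
    and \<pi>: "acts_strongly G (count_space (carrier G)) \<pi>"
  shows "folner_action G (count_space (carrier G)) F \<beta> \<pi>"
proof -
  interpret group G by fact
  have F: "finite (F n)" "F n \<noteq> {}" "F n \<subseteq> carrier G" for n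
    using F by (auto simp: folner_discrete_def)
  have F_pos: "0 < measure (count_space (carrier G)) (F n)" for n
    using F[of n] by (simp add: measure_count_space card_gt_0_iff)
  show ?thesis
  proof
    show "emeasure (count_space (carrier G)) (g <# A) = emeasure (count_space (carrier G)) A"
      if g: "g \<in> carrier G" and "A \<in> sets (count_space (carrier G))" for g A
    proof -
      have A: "A \<subseteq> carrier G" using that by simp
      have coset: "g <# A = (\<lambda>h. g \<otimes> h) ` A" by (auto simp: l_coset_def)
      have inj: "inj_on (\<lambda>h. g \<otimes> h) A" using g A by (intro inj_onI) (metis Units_eq Units_l_cancel subsetD)
      have "g <# A \<subseteq> carrier G" using g A by (auto simp: coset)
      with A show ?thesis
        by (simp add: emeasure_count_space coset finite_image_iff[OF inj] card_image[OF inj])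
    qed
    show "folner_modulus_lcsc G (count_space (carrier G)) F \<beta>"
      unfolding folner_modulus_lcsc_def
    proof (intro allI impI)
      fix n m and \<epsilon> :: real assume "0 < \<epsilon>" "\<beta> n \<epsilon> \<le> m"
      with \<beta> F F_pos show "\<exists>F'\<in>sets (count_space (carrier G)). F' \<subseteq> F n \<and>
          measure (count_space (carrier G)) (F n - F') < \<epsilon> * measure (count_space (carrier G)) (F n) \<and>
          (\<forall>g\<in>F'. measure (count_space (carrier G)) (sym_diff (F m) (g <# F m))
            < \<epsilon> * measure (count_space (carrier G)) (F m))"
        by (intro bexI[of _ "F n"]) (auto simp: folner_modulus_discrete_def)
    qed
  qed (use F F_pos \<pi> in \<open>auto simp: emeasure_count_space of_nat_less_top\<close>)
qed

theorem theorem39: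
  fixes G :: "('g, 'm) monoid_scheme"
    and T :: "'g topology"
    and M :: "'g measure"
    and F :: "nat \<Rightarrow> 'g set"
    and \<beta> :: "nat \<Rightarrow> real \<Rightarrow> nat"
    and u :: "real \<Rightarrow> real"
    and \<pi> :: "'g \<Rightarrow> 'b::banach \<Rightarrow>\<^sub>L 'b"
    and x :: 'b
    and \<epsilon> \<eta> :: real
  assumes "uniform_convexity_modulus TYPE('b) u"
    and "(group G \<and> countable (carrier G) \<and>
            T = discrete_topology (carrier G) \<and> M = count_space (carrier G) \<and>
            folner_discrete G M F \<and> folner_modulus_discrete G M F \<beta>)
       \<or> (lcsc_group G T \<and> left_haar_measure G T M \<and>
            folner_lcsc G T M F \<and> folner_modulus_lcsc G M F \<beta>)"
    and "\<forall>\<delta>>0. mono (\<lambda>n. \<beta> n \<delta>)"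
    and "acts_strongly G M \<pi>"
    and "\<epsilon> > 0"
    and "x \<noteq> 0" and "norm x \<le> 1"
    and "0 < \<eta>" and "\<eta> < u \<epsilon> / 2"
  shows "at_most_fluctuations_at_distance \<lfloor>2 * norm x / (u \<epsilon> - 2 * \<eta>)\<rfloor> \<epsilon>
           (\<lambda>n. \<beta> n (\<eta> / (3 * norm x))) (\<lambda>n. ergodic_average G M \<pi> F n x)
       \<and> (\<forall>L::real. (INF n. norm (ergodic_average G M \<pi> F n x)) \<ge> L \<longrightarrow>
           at_most_fluctuations_at_distance \<lfloor>2 * (norm x - L) / (u \<epsilon> - 2 * \<eta>)\<rfloor> \<epsilon>
             (\<lambda>n. \<beta> n (\<eta> / (3 * norm x))) (\<lambda>n. ergodic_average G M \<pi> F n x))"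
proof -
  interpret folner_action G M F \<beta> \<pi>
    using assms(2,4) folner_action_lcsc folner_action_discrete by blast
  have \<delta>: "0 < \<eta> / (3 * norm x)" using assms by simp
  \<comment> \<open>With \<delta> equal to \<open>\<eta> / (3 * norm x)\<close> the absorption error
    \<open>3 * \<delta> * norm x\<close> is exactly \<eta>, which turns the general bound into the
    stated one.\<close>
  have \<eta>: "3 * (\<eta> / (3 * norm x)) * norm x = \<eta>" using assms by simp
  have bound: "at_most_fluctuations_at_distance \<lfloor>2 * (norm x - L) / (u \<epsilon> - 2 * \<eta>)\<rfloor> \<epsilon>
      (\<lambda>n. \<beta> n (\<eta> / (3 * norm x))) (\<lambda>n. avg n x)" if "\<And>n. L \<le> norm (avg n x)" for L
    using avg_fluctuations[OF assms(1) \<open>\<epsilon> > 0\<close> \<open>norm x \<le> 1\<close> \<delta>, of L] assms(3) \<delta> that \<open>\<eta> < u \<epsilon> / 2\<close>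
    unfolding \<eta> by simp
  show ?thesis
  proof (intro conjI allI impI)
    show "at_most_fluctuations_at_distance \<lfloor>2 * norm x / (u \<epsilon> - 2 * \<eta>)\<rfloor> \<epsilon>
        (\<lambda>n. \<beta> n (\<eta> / (3 * norm x))) (\<lambda>n. avg n x)"
      \<comment> \<open>Norms are nonnegative, so 0 is an admissible lower bound
        \<open>L\<close>.\<close>
      using bound[of 0] by simp
  next
    fix L :: real assume L: "L \<le> (INF n. norm (avg n x))"
    show "at_most_fluctuations_at_distance \<lfloor>2 * (norm x - L) / (u \<epsilon> - 2 * \<eta>)\<rfloor> \<epsilon>
        (\<lambda>n. \<beta> n (\<eta> / (3 * norm x))) (\<lambda>n. avg n x)"
    proof (rule bound)
      \<comment> \<open>An infimum of reals lies below the members of the family only when the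
        family is bounded below; nonnegativity of norms ensures this.\<close>
      have "bdd_below (range (\<lambda>n. norm (avg n x)))" by (rule bdd_belowI[of _ 0]) auto
      then show "L \<le> norm (avg n x)" for n
        using L cINF_lower[of "\<lambda>n. norm (avg n x)" UNIV n] by simp
    qed
  qed
qed

end
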